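(* Let $V\in\tilde{\mathcal V}^+\cup\tilde{\mathcal V}^-$ and $V\neq \mathrm{Id}$. Then the following statements hold: (i) If $V\in\tilde{\mathcal V}^+$, then $\omega_V(\mathbf x_0)=\omega_V^{(w)}(\mathbf x_0)$ for all $\mathbf x_0\in S$. Moreover, $\omega_V^{(w)}(\mathbf x_0)\subset\partial S$ for all $\mathbf x_0\in S\setminus \mathrm{Fix}(V)$. (ii) If $V\in\tilde{\mathcal V}^-$, then for any $\mathbf x_0\in S\setminus \mathrm{Fix}(V)$ one has: (ii)$_a$ if $\omega_V(\mathbf x_0)\neq\emptyset$, then $\omega_V(\mathbf x_0)=\omega_V^{(w)}(\mathbf x_0)\subset\partial S$; (ii)$_b$ if $\omega_V(\mathbf x_0)=\emptyset$, then there exists $r$ with $0\le r<1$ such that $\omega_V^{(w)}(\mathbf x_0)\subset\partial S_r$.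
   Context: $\ell^1$ is the space of absolutely summable real sequences $\mathbf x=(x_k)_{k\ge1}$ with norm $\|\mathbf x\|=\sum_k|x_k|$. For $r\ge0$ let $S_r=\{\mathbf x\in\ell^1: x_k\ge0\ \text{for all }k,\ \|\mathbf x\|=r\}$, $\mathrm{ri}S_r=\{\mathbf x\in S_r: x_k>0\ \text{for all }k\in\mathbb N\}$, $\partial S_r=S_r\setminus \mathrm{ri}S_r$; write $S=S_1$, $\partial S=\partial S_1$. A Volterra operator is a map $V:S\to S$ of the form $(V(\mathbf x))_k=x_k\left(1+\sum_{i=1}^\infty a_{ki}x_i\right)$, $k\in\mathbb N$, where $(a_{ki})_{k,i\in\mathbb N}$ is a real matrix with $a_{ki}=-a_{ik}$ and $|a_{ki}|\le1$ for all $k,i$; this matrix is uniquely determined by $V$. $\mathrm{Id}$ is the identity operator (all $a_{ki}=0$) and $\mathrm{Fix}(V)=\{\mathbf x\in S:V(\mathbf x)=\mathbf x\}$. $V\in\tilde{\mathcal V}^+$ (resp. $V\in\tilde{\mathcal V}^-$) means that $V$ is a Volterra operator and there is an integer $k_0\ge1$ such that $a_{ki}=0$ whenever $k<k_0\le i$, and $a_{ki}\ge0$ (resp. $a_{ki}\le0$) whenever $k_0\le k<i$. Equivalently, the matrix is block diagonal with an arbitrary admissible skew-symmetric $(k_0-1)\times(k_0-1)$ block and an infinite block whose entries above the diagonal are all $\ge0$ (resp. all $\le 0$). For $\mathbf x_0\in S$, $\omega_V(\mathbf x_0)$ is the set of all limits, in $\ell^1$-norm, of subsequences $V^{n_j}(\mathbf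 x_0)$ ($n_j\to\infty$) of the trajectory $\{V^n(\mathbf x_0)\}$, where $V^n$ is the $n$-th iterate; $\omega_V^{(w)}(\mathbf x_0)$ is the set of all limits of such subsequences with respect to pointwise (coordinatewise) convergence in the space of all real sequences. *)

theory Defs
  imports Complex_Main "HOL-Library.FuncSet"
begin

text \<open>
  Real sequences \<open>(x\<^sub>k)\<close>, \<open>k = 1, 2, \<dots>\<close>, are functions of type \<^typ>\<open>nat \<Rightarrow> real\<close>;
  coordinate \<open>k\<close> of the paper is the value at \<open>k - 1\<close>. Matrices are shifted in the same way.
\<close>

definition l1 :: "(nat \<Rightarrow> real) set" where
  "l1 = {x. summable (\<lambda>k. \<bar>x k\<bar>)}"

definition l1_norm :: "(nat \<Rightarrow> real) \<Rightarrow> real" where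
  "l1_norm x = (\<Sum>k. \<bar>x k\<bar>)"

definition l1_simplex :: "real \<Rightarrow> (nat \<Rightarrow> real) set" where
  "l1_simplex r = {x \<in> l1. (\<forall>k. x k \<ge> 0) \<and> l1_norm x = r}"

definition ri_simplex :: "real \<Rightarrow> (nat \<Rightarrow> real) set" where
  "ri_simplex r = {x \<in> l1_simplex r. \<forall>k. x k > 0}"

definition bd_simplex :: "real \<Rightarrow> (nat \<Rightarrow> real) set" where
  "bd_simplex r = l1_simplex r - ri_simplex r"

definition admissible :: "(nat \<Rightarrow> nat \<Rightarrow> real) \<Rightarrow> bool" where
  "admissible a \<longleftrightarrow> (\<forall>k i. a k i = - a i k \<and> \<bar>a k i\<bar> \<le> 1)"

text \<open>
  Maps \<open>S \<rightarrow> S\<close> are represented extensionally, so that equality of operators in HOL is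
  equality of maps on \<open>S\<close>. The series below converges absolutely for admissible \<open>a\<close> and \<open>x \<in> S\<close>.
\<close>

definition volterra_with :: "(nat \<Rightarrow> nat \<Rightarrow> real) \<Rightarrow> ((nat \<Rightarrow> real) \<Rightarrow> (nat \<Rightarrow> real)) \<Rightarrow> bool" where
  "volterra_with a V \<longleftrightarrow>
     admissible a \<and> V \<in> l1_simplex 1 \<rightarrow>\<^sub>E l1_simplex 1 \<and>
     (\<forall>x\<in>l1_simplex 1. \<forall>k. V x k = x k * (1 + (\<Sum>i. a k i * x i)))"

definition Id_op :: "(nat \<Rightarrow> real) \<Rightarrow> (nat \<Rightarrow> real)" where
  "Id_op = (\<lambda>x\<in>l1_simplex 1. x)"

definition Fix :: "((nat \<Rightarrow> real) \<Rightarrow> (nat \<Rightarrow> real)) \<Rightarrow> (nat \<Rightarrow> real) set" where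
  "Fix V = {x \<in> l1_simplex 1. V x = x}"

text \<open>
  The number \<open>m\<close> is \<open>k\<^sub>0 - 1\<close>, the size of the finite diagonal block; \<open>k\<^sub>0 \<ge> 1\<close> becomes \<open>m \<ge> 0\<close>.
  The matrix of a Volterra operator is unique, so quantifying over it existentially is harmless.
\<close>

definition volterra_plus :: "((nat \<Rightarrow> real) \<Rightarrow> (nat \<Rightarrow> real)) set" where
  "volterra_plus =
     {V. \<exists>a. volterra_with a V \<and>
        (\<exists>m. (\<forall>k i. k < m \<and> m \<le> i \<longrightarrow> a k i = 0) \<and>
             (\<forall>k i. m \<le> k \<and> k < i \<longrightarrow> a k i \<ge> 0))}"

definition volterra_minus :: "((nat \<Rightarrow> real) \<Rightarrow> (nat \<Rightarrow> real)) set" where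
  "volterra_minus =
     {V. \<exists>a. volterra_with a V \<and>
        (\<exists>m. (\<forall>k i. k < m \<and> m \<le> i \<longrightarrow> a k i = 0) \<and>
             (\<forall>k i. m \<le> k \<and> k < i \<longrightarrow> a k i \<le> 0))}"

definition omega_norm ::
  "((nat \<Rightarrow> real) \<Rightarrow> (nat \<Rightarrow> real)) \<Rightarrow> (nat \<Rightarrow> real) \<Rightarrow> (nat \<Rightarrow> real) set" where
  "omega_norm V x0 =
     {y \<in> l1. \<exists>n :: nat \<Rightarrow> nat. strict_mono n \<and>
        (\<lambda>j. l1_norm (\<lambda>k. (V ^^ n j) x0 k - y k)) \<longlonglongrightarrow> 0}"

definition omega_weak ::
  "((nat \<Rightarrow> real) \<Rightarrow> (nat \<Rightarrow> real)) \<Rightarrow> (nat \<Rightarrow> real) \<Rightarrow> (nat \<Rightarrow> real) set" where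
  "omega_weak V x0 =
     {y. \<exists>n :: nat \<Rightarrow> nat. strict_mono n \<and>
        (\<forall>k. (\<lambda>j. (V ^^ n j) x0 k) \<longlonglongrightarrow> y k)}"

end

theory Submission
  imports Defs "HOL-Analysis.Uniform_Limit"
begin

text \<open>
  The matrix splits the coordinates into a finite head (\<open>k < m\<close>) and an infinite tail (\<open>k \<ge> m\<close>) that
  do not interact, so the head keeps its mass. In the tail, skew-symmetry makes the change of a
  partial sum \<open>\<Sum>k\<in>{m..<n}. x k\<close> equal to the flow across its upper end (\<open>mass_flow\<close>), and by
  the sign condition all contributions to that flow have the same sign. Hence these partial sums are
  monotone along an orbit and every tail coordinate converges along the whole orbit.

  This determines the masses of the weak limits. All weak limits of an orbit have the same tail and the same head
  mass, hence the same total mass, which is at most 1 (\<open>omega_weak_equal_mass\<close>). In the plus case partial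
  sums can only grow, so no mass escapes to infinity and the total is 1. A weak limit is a norm limit
  exactly if its mass is 1 (\<open>omega_norm_eq\<close>): for nonnegative sequences of equal mass pointwise
  convergence is norm convergence, by Scheffe's argument. So either all weak limits are norm limits, or
  none is and they lie in one simplex of mass below 1.

  It remains to see that an orbit having a strictly positive weak limit \<open>y\<close> starts at a fixed point
  (\<open>interior_limit_imp_fixed\<close>). In the tail, the flow across each cut tends to 0, and so does each of its
  contributions \<open>a k i * x k * x i\<close>; thus \<open>a k i * y k * y i = 0\<close>, and the whole tail block of the
  matrix is 0. In the head, the functions \<open>\<Sum>k<m. p k * ln (x k)\<close> decrease along orbits if
  \<open>p \<ge> 0\<close> and \<open>A p \<ge> 0\<close>, where \<open>A\<close> is the head block. Tucker's theorem on skew-symmetric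
  matrices supplies such a \<open>p\<close> with \<open>p k > 0\<close> or \<open>(A p) k > 0\<close> for a prescribed \<open>k\<close>. The function has
  a finite limit because \<open>y\<close> is positive, so its decrement vanishes at \<open>y\<close>, and this gives
  \<open>(A y) k = 0\<close>. Now \<open>p = y\<close> is itself a legitimate choice, and \<open>\<Sum>k<m. y k * ln (x k)\<close> has its strict
  maximum over vectors of the mass of \<open>y\<close> at \<open>x = y\<close>. It decreases along the orbit and yet comes
  arbitrarily close to this maximum, so the head of the orbit starts at \<open>y\<close>, where it rests.
\<close>

section \<open>Tucker's theorem for skew-symmetric matrices\<close>

text \<open>
  Tucker's induction on the set of columns. If the solution \<open>u\<close> obtained without the new column
  violates its inequality, multiples of the new column are added to the old ones until
  all of them are orthogonal to \<open>u\<close>. A solution for the changed columns may then be moved along \<open>u\<close>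
  without affecting them, until it is orthogonal to the new column as well.
\<close>

lemma tucker_positive_column:
  fixes C :: "'j \<Rightarrow> 'i \<Rightarrow> real"
  assumes "finite I" "finite J" "j0 \<notin> J"
  shows "\<exists>u x. (\<forall>j\<in>insert j0 J. 0 \<le> (\<Sum>i\<in>I. C j i * u i)) \<and> (\<forall>j\<in>insert j0 J. 0 \<le> x j) \<and>
           (\<forall>i\<in>I. (\<Sum>j\<in>insert j0 J. x j * C j i) = 0) \<and> 0 < (\<Sum>i\<in>I. C j0 i * u i) + x j0"
  using assms(2,3)
proof (induction J arbitrary: C rule: finite_induct)
  case empty
  show ?case
  proof (cases "\<forall>i\<in>I. C j0 i = 0")
    case True
    then show ?thesis
      by (intro exI[of _ "\<lambda>_. 0"] exI[of _ "\<lambda>_. 1"]) auto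
  next
    case False
    then obtain i where i: "i \<in> I" "C j0 i \<noteq> 0" by auto
    have "0 < (\<Sum>i\<in>I. C j0 i * C j0 i)"
      by (rule sum_pos2[OF assms(1) i(1)]) (use i in \<open>auto simp flip: power2_eq_square\<close>)
    then show ?thesis
      by (intro exI[of _ "C j0"] exI[of _ "\<lambda>_. 0"]) auto
  qed
next
  case (insert j1 J)
  define D where "D v j = (\<Sum>i\<in>I. C j i * v i)" for v j
  obtain u x where u: "\<And>j. j \<in> insert j0 J \<Longrightarrow> 0 \<le> D u j" and x: "\<And>j. j \<in> insert j0 J \<Longrightarrow> 0 \<le> x j"
    and ux: "\<And>i. i \<in> I \<Longrightarrow> (\<Sum>j\<in>insert j0 J. x j * C j i) = 0" "0 < D u j0 + x j0"
    using insert.IH[of C] insert.prems unfolding D_def by blast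
  have j1: "j1 \<notin> insert j0 J" "j0 \<noteq> j1" using insert by auto
  have ins: "insert j0 (insert j1 J) = insert j1 (insert j0 J)" by auto
  show ?case
  proof (cases "0 \<le> D u j1")
    case True
    define x' where "x' = x(j1 := 0)"
    have "(\<Sum>j\<in>insert j1 (insert j0 J). x' j * C j i) = (\<Sum>j\<in>insert j0 J. x j * C j i)" for i
      using j1 insert.hyps unfolding x'_def
      by (subst sum.insert) (auto intro!: sum.cong)
    then show ?thesis unfolding ins
      using u x ux True j1 unfolding D_def
      by (intro exI[of _ u] exI[of _ x']) (auto simp: x'_def)
  next
    case False
    define l where "l j = - D u j / D u j1" for j
    have l: "0 \<le> l j" if "j \<in> insert j0 J" for j
      using u[OF that] False by (auto simp: l_def field_simps)
    \<comment> \<open>The coefficients \<open>l j\<close> are chosen such that every \<open>B j\<close> is orthogonal to \<open>u\<close>.\<close>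
    define B where "B j i = C j i + l j * C j1 i" for j i
    have BD: "(\<Sum>i\<in>I. B j i * v i) = D v j + l j * D v j1" for v j
      unfolding B_def D_def by (simp add: sum.distrib sum_distrib_left algebra_simps)
    obtain v y where v: "\<And>j. j \<in> insert j0 J \<Longrightarrow> 0 \<le> D v j + l j * D v j1"
      and y: "\<And>j. j \<in> insert j0 J \<Longrightarrow> 0 \<le> y j"
      and vy: "\<And>i. i \<in> I \<Longrightarrow> (\<Sum>j\<in>insert j0 J. y j * B j i) = 0" "0 < D v j0 + l j0 * D v j1 + y j0"
      using insert.IH[of B] insert.prems unfolding BD by blast
    define y' where "y' = y(j1 := (\<Sum>j\<in>insert j0 J. l j * y j))"
    define w where "w i = v i - (D v j1 / D u j1) * u i" for i
    have w: "D w j = D v j + l j * D v j1" for j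
      unfolding D_def w_def l_def
      by (simp add: sum_subtractf sum_distrib_left algebra_simps sum_divide_distrib)
    have w1: "D w j1 = 0" unfolding w l_def using False by auto
    have "(\<Sum>j\<in>insert j1 (insert j0 J). y' j * C j i) = (\<Sum>j\<in>insert j0 J. y j * B j i)" for i
    proof -
      have "(\<Sum>j\<in>insert j1 (insert j0 J). y' j * C j i)
          = (\<Sum>j\<in>insert j0 J. l j * y j) * C j1 i + (\<Sum>j\<in>insert j0 J. y j * C j i)"
        using j1 insert.hyps unfolding y'_def
        by (subst sum.insert) (auto intro!: sum.cong)
      also have "\<dots> = (\<Sum>j\<in>insert j0 J. y j * B j i)"
        unfolding B_def by (simp only: sum_distrib_right flip: sum.distrib) (simp add: algebra_simps)
      finally show ?thesis .
    qed
    moreover have "0 \<le> y' j1" using l y by (auto simp: y'_def intro!: sum_nonneg)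
    moreover have "y' j = y j" if "j \<in> insert j0 J" for j using that j1 by (auto simp: y'_def)
    ultimately show ?thesis unfolding ins D_def[symmetric]
      using v y vy w w1
      by (intro exI[of _ w] exI[of _ y']) auto
  qed
qed

text \<open>
  The previous lemma is applied to the rows of \<open>A\<close> together with the unit vectors, the \<open>k\<close>-th of these
  being the distinguished column. The inequalities say that \<open>u \<ge> 0\<close> and \<open>A u \<ge> 0\<close>; the linear
  relation, by skew-symmetry, says that the coefficients of the unit vectors form \<open>A x\<close>,
  where \<open>x \<ge> 0\<close> are the coefficients of the rows. So \<open>p = u + x\<close> has the required properties.
\<close>

lemma skew_strictly_complementary:
  fixes a :: "nat \<Rightarrow> nat \<Rightarrow> real"
  assumes skew: "\<And>i j. i < m \<Longrightarrow> j < m \<Longrightarrow> a i j = - a j i" and k: "k < m"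
  obtains p where "\<And>i. i < m \<Longrightarrow> 0 \<le> p i" "\<And>i. i < m \<Longrightarrow> 0 \<le> (\<Sum>j<m. a i j * p j)"
    "0 < p k + (\<Sum>j<m. a k j * p j)"
proof -
  define C :: "nat + nat \<Rightarrow> nat \<Rightarrow> real"
    where "C = case_sum a (\<lambda>k i. if i = k then 1 else 0)"
  define J :: "(nat + nat) set" where "J = ({..<m} <+> {..<m}) - {Inr k}"
  have J: "insert (Inr k) J = {..<m} <+> {..<m}" using k by (auto simp: J_def)
  obtain u x where u: "\<forall>j\<in>{..<m} <+> {..<m}. 0 \<le> (\<Sum>i<m. C j i * u i)"
    and x: "\<forall>j\<in>{..<m} <+> {..<m}. 0 \<le> x j"
    and ux: "\<forall>i\<in>{..<m}. (\<Sum>j\<in>{..<m} <+> {..<m}. x j * C j i) = 0"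
      "0 < (\<Sum>i<m. C (Inr k) i * u i) + x (Inr k)"
    using tucker_positive_column[of "{..<m}" J "Inr k" C] unfolding J by (auto simp: J_def)
  have unit: "(\<Sum>i<m. C (Inr l) i * v i) = v l" if "l < m" for l and v :: "nat \<Rightarrow> real"
    using that by (simp add: C_def if_distrib[of "\<lambda>c. c * _"] sum.delta cong: if_cong)
  have slack: "x (Inr i) = (\<Sum>j<m. a i j * x (Inl j))" if i: "i < m" for i
  proof -
    have "(\<Sum>j<m. x (Inl j) * a j i) + (\<Sum>l<m. x (Inr l) * (if i = l then 1 else 0)) = 0"
      using ux(1) i by (simp add: sum.Plus C_def)
    moreover have "(\<Sum>l<m. x (Inr l) * (if i = l then 1 else 0)) = x (Inr i)"
      using i by (simp add: if_distrib[of "\<lambda>c. _ * c"] sum.delta' cong: if_cong)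
    moreover have "(\<Sum>j<m. x (Inl j) * a j i) = - (\<Sum>j<m. a i j * x (Inl j))"
      unfolding sum_negf[symmetric] by (rule sum.cong) (use skew[OF i] in auto)
    ultimately show ?thesis by linarith
  qed
  have u': "0 \<le> u i" "0 \<le> (\<Sum>j<m. a i j * u j)" if "i < m" for i
    using u that unit[OF that, of u] by (force, force simp: C_def)
  have x': "0 \<le> x (Inl i)" "0 \<le> x (Inr i)" if "i < m" for i
    using x that by auto
  have dist: "(\<Sum>j<m. a i j * (u j + x (Inl j))) = (\<Sum>j<m. a i j * u j) + x (Inr i)" if "i < m" for i
    by (simp add: slack[OF that] sum.distrib algebra_simps)
  show thesis
  proof (rule that[of "\<lambda>i. u i + x (Inl i)"])
    show "0 < u k + x (Inl k) + (\<Sum>j<m. a k j * (u j + x (Inl j)))"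
      using ux(2) unit[OF k, of u] u'[OF k] x'[OF k] dist[OF k] by linarith
  qed (use u' x' dist in auto)
qed

section \<open>Finite Volterra dynamics with an interior limit point\<close>

lemma skew_form_zero:
  fixes a :: "nat \<Rightarrow> nat \<Rightarrow> real"
  assumes "\<And>i j. i \<in> I \<Longrightarrow> j \<in> I \<Longrightarrow> a i j = - a j i"
  shows "(\<Sum>k\<in>I. x k * (\<Sum>i\<in>I. a k i * x i)) = 0"
proof -
  have "(\<Sum>k\<in>I. x k * (\<Sum>i\<in>I. a k i * x i)) = (\<Sum>k\<in>I. \<Sum>i\<in>I. a k i * x k * x i)"
    by (simp add: sum_distrib_left algebra_simps)
  also have "\<dots> = (\<Sum>k\<in>I. \<Sum>i\<in>I. a i k * x i * x k)" by (rule sum.swap)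
  also have "\<dots> = (\<Sum>k\<in>I. \<Sum>i\<in>I. - (a k i * x k * x i))"
  proof (intro sum.cong refl)
    fix k i assume "k \<in> I" "i \<in> I"
    then have "a i k = - a k i" using assms by blast
    then show "a i k * x i * x k = - (a k i * x k * x i)" by simp
  qed
  also have "\<dots> = - (\<Sum>k\<in>I. x k * (\<Sum>i\<in>I. a k i * x i))"
    by (simp add: sum_negf sum_distrib_left algebra_simps)
  finally show ?thesis by simp
qed

locale finite_volterra_orbit =
  fixes a :: "nat \<Rightarrow> nat \<Rightarrow> real" and m :: nat and x :: "nat \<Rightarrow> nat \<Rightarrow> real"
  assumes skew: "i < m \<Longrightarrow> j < m \<Longrightarrow> a i j = - a j i"
    and bounded: "i < m \<Longrightarrow> j < m \<Longrightarrow> \<bar>a i j\<bar> \<le> 1"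
    and pos: "k < m \<Longrightarrow> 0 < x n k"
    and mass_le_1: "(\<Sum>k<m. x n k) \<le> 1"
    and step: "k < m \<Longrightarrow> x (Suc n) k = x n k * (1 + (\<Sum>i<m. a k i * x n i))"
begin

lemma mass_constant: "(\<Sum>k<m. x n k) = (\<Sum>k<m. x 0 k)"
proof (induction n)
  case (Suc n)
  have "(\<Sum>k<m. x (Suc n) k) = (\<Sum>k<m. x n k) + (\<Sum>k<m. x n k * (\<Sum>i<m. a k i * x n i))"
    by (simp add: step algebra_simps sum.distrib)
  moreover have "(\<Sum>k<m. x n k * (\<Sum>i<m. a k i * x n i)) = 0"
    by (rule skew_form_zero) (use skew in blast)
  ultimately show ?case using Suc by simp
qed simp

text \<open>
  In the worst case \<open>k\<close> loses against every other coordinate at the maximal rate 1, and these have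
  at most the mass \<open>1 - x n k\<close>. The bound keeps the growth factor away from 0 in the limit, so that its
  logarithm passes to the limit.
\<close>

lemma growth_factor_ge:
  assumes k: "k < m"
  shows "x n k \<le> 1 + (\<Sum>i<m. a k i * x n i)"
proof -
  have "a k k = 0" using skew[OF k k] by simp
  then have "x n k = (\<Sum>i<m. (a k i + (if i = k then 1 else 0)) * x n i) - (\<Sum>i<m. a k i * x n i)"
    using k by (simp add: algebra_simps sum.distrib if_distrib[of "\<lambda>c. _ * c"] sum.delta cong: if_cong)
  moreover have "(\<Sum>i<m. - x n i) \<le> (\<Sum>i<m. a k i * x n i + (if i = k then - x n i else 0))"
  proof (rule sum_mono)
    fix i assume i: "i \<in> {..<m}"
    have "- 1 * x n i \<le> a k i * x n i"
      by (rule mult_right_mono) (use bounded[OF k, of i] pos[of i n] i in auto)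
    then show "- x n i \<le> a k i * x n i + (if i = k then - x n i else 0)"
      using \<open>a k k = 0\<close> by auto
  qed
  ultimately show ?thesis
    using mass_le_1[of n] k by (simp add: sum_negf sum.distrib sum.delta)
qed

text \<open>The logarithm of the product of the powers \<open>x k powr p k\<close>.\<close>

definition lyapunov :: "(nat \<Rightarrow> real) \<Rightarrow> nat \<Rightarrow> real"
  where "lyapunov p n = (\<Sum>k<m. p k * ln (x n k))"

text \<open>
  The decrement is arranged as a sum of terms that are nonnegative if \<open>p\<close> and \<open>A p\<close> are, since
  \<open>ln (1 + t) \<le> t\<close>. The second sum arises by moving \<open>A\<close> from \<open>x n\<close> to \<open>p\<close> by skew-symmetry.
\<close>

lemma lyapunov_decrement:
  "lyapunov p n - lyapunov p (Suc n) =
     (\<Sum>k<m. p k * ((\<Sum>i<m. a k i * x n i) - ln (1 + (\<Sum>i<m. a k i * x n i)))) +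
     (\<Sum>k<m. (\<Sum>i<m. a k i * p i) * x n k)"
proof -
  have ln_step: "ln (x (Suc n) k) = ln (x n k) + ln (1 + (\<Sum>i<m. a k i * x n i))" if "k < m" for k
    using that pos[OF that, of n] growth_factor_ge[OF that, of n] by (simp add: step ln_mult)
  have "(\<Sum>k<m. (\<Sum>i<m. a k i * p i) * x n k) = (\<Sum>k<m. \<Sum>i<m. a k i * p i * x n k)"
    by (simp add: sum_distrib_right)
  also have "\<dots> = (\<Sum>i<m. \<Sum>k<m. a k i * p i * x n k)" by (rule sum.swap)
  also have "\<dots> = (\<Sum>i<m. \<Sum>k<m. - (p i * (a i k * x n k)))"
  proof (intro sum.cong refl)
    fix i k assume "i \<in> {..<m}" "k \<in> {..<m}"
    then have "a k i = - a i k" using skew by blast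
    then show "a k i * p i * x n k = - (p i * (a i k * x n k))" by simp
  qed
  also have "\<dots> = - (\<Sum>k<m. p k * (\<Sum>i<m. a k i * x n i))"
    by (simp add: sum_negf sum_distrib_left)
  finally show ?thesis
    by (simp add: lyapunov_def ln_step algebra_simps sum.distrib sum_subtractf)
qed

lemma lyapunov_decseq:
  assumes p: "\<And>k. k < m \<Longrightarrow> 0 \<le> p k" "\<And>k. k < m \<Longrightarrow> 0 \<le> (\<Sum>i<m. a k i * p i)"
  shows "decseq (lyapunov p)"
proof (rule decseq_SucI)
  fix n
  have "0 \<le> (\<Sum>k<m. p k * ((\<Sum>i<m. a k i * x n i) - ln (1 + (\<Sum>i<m. a k i * x n i))))"
  proof (rule sum_nonneg)
    fix k assume "k \<in> {..<m}"
    then show "0 \<le> p k * ((\<Sum>i<m. a k i * x n i) - ln (1 + (\<Sum>i<m. a k i * x n i)))"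
      using p(1) ln_le_minus_one[of "1 + (\<Sum>i<m. a k i * x n i)"] pos[of k n]
        growth_factor_ge[of k n] by auto
  qed
  moreover have "0 \<le> (\<Sum>k<m. (\<Sum>i<m. a k i * p i) * x n k)"
    by (rule sum_nonneg) (use p(2) pos in \<open>simp add: less_imp_le\<close>)
  ultimately show "lyapunov p (Suc n) \<le> lyapunov p n"
    using lyapunov_decrement[of p n] by linarith
qed

context
  fixes y :: "nat \<Rightarrow> real" and s :: "nat \<Rightarrow> nat"
  assumes s: "strict_mono s"
    and lim: "k < m \<Longrightarrow> (\<lambda>j. x (s j) k) \<longlonglongrightarrow> y k"
    and y_pos: "k < m \<Longrightarrow> 0 < y k"
begin

lemma lyapunov_lim: "(\<lambda>j. lyapunov p (s j)) \<longlonglongrightarrow> (\<Sum>k<m. p k * ln (y k))"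
  unfolding lyapunov_def
proof (intro tendsto_sum tendsto_mult tendsto_const tendsto_ln)
  fix k assume "k \<in> {..<m}"
  then show "(\<lambda>j. x (s j) k) \<longlonglongrightarrow> y k" "y k \<noteq> 0" using lim y_pos[of k] by auto
qed

lemma growth_lim: "(\<lambda>j. \<Sum>i<m. a k i * x (s j) i) \<longlonglongrightarrow> (\<Sum>i<m. a k i * y i)"
  by (intro tendsto_sum tendsto_mult tendsto_const) (simp add: lim)

lemma growth_lim_pos: 
  assumes "k < m" shows "0 < 1 + (\<Sum>i<m. a k i * y i)"
proof -
  have "y k \<le> 1 + (\<Sum>i<m. a k i * y i)"
    by (rule LIMSEQ_le[OF lim[OF assms] tendsto_add[OF tendsto_const growth_lim]])
       (use growth_factor_ge[OF assms] in auto)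
  then show ?thesis using y_pos[OF assms] by linarith
qed

text \<open>
  The decrements of \<open>lyapunov p\<close> tend to 0, so all nonnegative terms of the decrement vanish at \<open>y\<close>. As \<open>y\<close>
  is positive, \<open>A p = 0\<close>; strict complementarity at \<open>k\<close> then forces \<open>p k > 0\<close>, and \<open>ln (1 + t) = t\<close>
  only for \<open>t = 0\<close>.
\<close>

lemma interior_limit_fixed:
  assumes k: "k < m"
  shows "(\<Sum>i<m. a k i * y i) = 0"
proof -
  obtain p where p: "\<And>i. i < m \<Longrightarrow> 0 \<le> p i" "\<And>i. i < m \<Longrightarrow> 0 \<le> (\<Sum>j<m. a i j * p j)"
    "0 < p k + (\<Sum>j<m. a k j * p j)"
    by (rule skew_strictly_complementary[of m a k, OF _ k]) (use skew in blast)+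
  have dec: "decseq (lyapunov p)" using lyapunov_decseq p by blast
  have lower: "(\<Sum>k<m. p k * ln (y k)) \<le> lyapunov p n" for n
  proof (rule LIMSEQ_le_const2[OF lyapunov_lim])
    show "\<exists>N. \<forall>j\<ge>N. lyapunov p (s j) \<le> lyapunov p n"
      using decseqD[OF dec] seq_suble[OF s] by (metis order_trans)
  qed
  obtain L where L: "lyapunov p \<longlonglongrightarrow> L"
    using decseq_convergent[OF dec] lower by blast
  have "(\<lambda>n. lyapunov p n - lyapunov p (Suc n)) \<longlonglongrightarrow> 0"
    using tendsto_diff[OF L LIMSEQ_Suc[OF L]] by simp
  then have "(\<lambda>j. lyapunov p (s j) - lyapunov p (Suc (s j))) \<longlonglongrightarrow> 0"
    using LIMSEQ_subseq_LIMSEQ[OF _ s] by (auto simp: comp_def)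
  moreover have "(\<lambda>j. lyapunov p (s j) - lyapunov p (Suc (s j))) \<longlonglongrightarrow>
     (\<Sum>k<m. p k * ((\<Sum>i<m. a k i * y i) - ln (1 + (\<Sum>i<m. a k i * y i)))) +
     (\<Sum>k<m. (\<Sum>i<m. a k i * p i) * y k)"
    unfolding lyapunov_decrement
  proof (intro tendsto_add tendsto_sum tendsto_mult tendsto_diff tendsto_ln tendsto_const growth_lim)
    fix k assume "k \<in> {..<m}"
    then show "(\<lambda>j. x (s j) k) \<longlonglongrightarrow> y k" "1 + (\<Sum>i<m. a k i * y i) \<noteq> 0"
      using lim growth_lim_pos[of k] by auto
  qed (use lim in simp_all)
  ultimately have zero: "(\<Sum>k<m. p k * ((\<Sum>i<m. a k i * y i) - ln (1 + (\<Sum>i<m. a k i * y i)))) +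
     (\<Sum>k<m. (\<Sum>i<m. a k i * p i) * y k) = 0"
    by (rule LIMSEQ_unique[symmetric])
  have nn1: "0 \<le> p k * ((\<Sum>i<m. a k i * y i) - ln (1 + (\<Sum>i<m. a k i * y i)))" if "k < m" for k
    using ln_le_minus_one[OF growth_lim_pos[OF that]] p(1)[OF that] by auto
  have nn2: "0 \<le> (\<Sum>i<m. a k i * p i) * y k" if "k < m" for k
    using p(2)[OF that] y_pos[OF that] by auto
  have "0 \<le> (\<Sum>k<m. (\<Sum>i<m. a k i * p i) * y k)"
    and "0 \<le> (\<Sum>k<m. p k * ((\<Sum>i<m. a k i * y i) - ln (1 + (\<Sum>i<m. a k i * y i))))"
    by (intro sum_nonneg; use nn1 nn2 in simp)+
  then have sums: "(\<Sum>k<m. (\<Sum>i<m. a k i * p i) * y k) = 0"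
    "(\<Sum>k<m. p k * ((\<Sum>i<m. a k i * y i) - ln (1 + (\<Sum>i<m. a k i * y i)))) = 0"
    using zero by linarith+
  have "(\<Sum>i<m. a k i * p i) * y k = 0"
    by (rule sum_nonneg_0[OF _ _ sums(1)]) (use nn2 k in simp_all)
  moreover have z: "p k * ((\<Sum>i<m. a k i * y i) - ln (1 + (\<Sum>i<m. a k i * y i))) = 0"
    by (rule sum_nonneg_0[OF _ _ sums(2)]) (use nn1 k in simp_all)
  ultimately have "p k > 0" using p(3) y_pos[OF k] by auto
  then have "ln (1 + (\<Sum>i<m. a k i * y i)) = (1 + (\<Sum>i<m. a k i * y i)) - 1"
    using z by auto
  then show ?thesis using ln_eq_minus_one[OF growth_lim_pos[OF k]] by simp
qed

text \<open>
  By the previous lemma \<open>lyapunov y\<close> decreases to its value at \<open>y\<close>. The numbers \<open>g k\<close> below are the terms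
  of the relative entropy of \<open>y\<close> with respect to \<open>x 0\<close>, completed by \<open>x 0 k - y k\<close> to be
  nonnegative; these corrections cancel because the mass is conserved.
\<close>

lemma interior_limit_eq_start:
  assumes k: "k < m"
  shows "x 0 k = y k"
proof -
  have "decseq (lyapunov y)"
    using lyapunov_decseq[of y] interior_limit_fixed y_pos by (auto intro: less_imp_le)
  then have "(\<Sum>k<m. y k * ln (y k)) \<le> lyapunov y 0"
    by (intro LIMSEQ_le_const2[OF lyapunov_lim]) (auto simp: decseq_def)
  moreover have "(\<lambda>j. \<Sum>k<m. x (s j) k) \<longlonglongrightarrow> (\<Sum>k<m. y k)"
    by (intro tendsto_sum) (simp add: lim)
  then have mass: "(\<Sum>k<m. y k) = (\<Sum>k<m. x 0 k)"
    unfolding mass_constant[of "s _"] by (simp add: LIMSEQ_const_iff)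
  define g where "g k = y k * ((x 0 k / y k - 1) - ln (x 0 k / y k))" for k
  have g_eq: "g k = x 0 k - y k - y k * ln (x 0 k) + y k * ln (y k)" if "k < m" for k
    using y_pos[OF that] pos[OF that, of 0] by (simp add: g_def ln_div field_simps)
  ultimately have "(\<Sum>k<m. g k) \<le> 0"
    by (simp add: g_eq sum.distrib sum_subtractf lyapunov_def mass)
  moreover have nn: "0 \<le> g k" if "k < m" for k
    using y_pos[OF that] pos[OF that, of 0] ln_le_minus_one[of "x 0 k / y k"]
    by (simp add: g_def)
  ultimately have "(\<Sum>k<m. g k) = 0" by (meson lessThan_iff order_antisym sum_nonneg)
  then have "g k = 0" using k nn sum_nonneg_0[of "{..<m}" g k] by simp
  then have "ln (x 0 k / y k) = x 0 k / y k - 1" using y_pos[OF k] by (auto simp: g_def)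
  then have "x 0 k / y k = 1"
    by (intro ln_eq_minus_one) (use y_pos[OF k] pos[OF k, of 0] in simp_all)
  then show ?thesis using y_pos[OF k] by simp
qed

lemma interior_limit_imp_start_fixed:
  assumes "k < m"
  shows "(\<Sum>i<m. a k i * x 0 i) = 0"
  using interior_limit_fixed[OF assms] by (simp add: interior_limit_eq_start)

end

end

section \<open>Pointwise and norm convergence in the simplex\<close>

lemma mem_l1_simplex_iff: "x \<in> l1_simplex r \<longleftrightarrow> (\<forall>k. 0 \<le> x k) \<and> x sums r"
  by (auto simp: l1_simplex_def l1_def l1_norm_def sums_iff)

lemma l1_simplexD:
  assumes "x \<in> l1_simplex r"
  shows "0 \<le> x k" "summable x" "suminf x = r"
  using assms by (auto simp: mem_l1_simplex_iff sums_iff)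

lemma sum_le_l1_simplex:
  assumes "x \<in> l1_simplex r" "finite I"
  shows "sum x I \<le> r"
  using sum_le_suminf[OF l1_simplexD(2)[OF assms(1)] assms(2)] l1_simplexD[OF assms(1)] by auto

text \<open>
  Scheffe's argument: as the masses agree, the norm of \<open>x j - y\<close> is twice the sum of the positive
  parts of \<open>y - x j\<close>. These are dominated by \<open>y\<close>, so limit and sum may be interchanged.
\<close>

lemma pointwise_limit_equal_mass_imp_norm_limit:
  assumes x: "\<And>j. x j \<in> l1_simplex r" and y: "y \<in> l1_simplex r"
    and lim: "\<And>k. (\<lambda>j. x j k) \<longlonglongrightarrow> y k"
  shows "(\<lambda>j. l1_norm (\<lambda>k. x j k - y k)) \<longlonglongrightarrow> 0"
proof -
  define d where "d k j = max 0 (y k - x j k)" for k j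
  have d_le: "\<bar>d k j\<bar> \<le> y k" for k j
    using l1_simplexD(1)[OF x, of j k] l1_simplexD(1)[OF y, of k] by (auto simp: d_def)
  have d_sum: "summable (\<lambda>k. d k j)" for j
    by (rule summable_comparison_test'[OF l1_simplexD(2)[OF y]]) (use d_le in auto)
  have "l1_norm (\<lambda>k. x j k - y k) = 2 * (\<Sum>k. d k j)" for j
  proof -
    have eq: "\<bar>x j k - y k\<bar> = (x j k - y k) + 2 * d k j" for k by (auto simp: d_def max_def)
    have s: "summable (\<lambda>k. x j k - y k)"
      by (intro summable_diff l1_simplexD(2)[OF x] l1_simplexD(2)[OF y])
    have "(\<Sum>k. x j k - y k) = 0"
      using suminf_diff[OF l1_simplexD(2)[OF x] l1_simplexD(2)[OF y], of j]
        l1_simplexD(3)[OF x, of j] l1_simplexD(3)[OF y] by simp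
    then show ?thesis
      unfolding l1_norm_def eq
      by (simp add: suminf_add[OF s summable_mult[OF d_sum], symmetric] suminf_mult[OF d_sum])
  qed
  moreover have "(\<lambda>j. \<Sum>k. d k j) \<longlonglongrightarrow> (\<Sum>k. 0)"
  proof (rule conjunct2[OF conjunct2[OF tannerys_theorem]])
    fix k show "(\<lambda>j. d k j) \<longlonglongrightarrow> 0"
      unfolding d_def using tendsto_max[OF tendsto_const[of 0] tendsto_diff[OF tendsto_const lim], of "y k" k]
      by simp
  next
    show "\<forall>\<^sub>F (k, n) in sequentially \<times>\<^sub>F sequentially. norm (d k n) \<le> y k"
      by (rule always_eventually) (use d_le in auto)
  qed (use l1_simplexD(2)[OF y] in auto)
  ultimately show ?thesis using tendsto_mult_right_zero[of _ sequentially 2] by simp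
qed

section \<open>Flow of mass in the tail block\<close>

text \<open>The parameter \<open>\<sigma>\<close> is 1 in the plus case and -1 in the minus case.\<close>

locale block_signed_volterra =
  fixes V :: "(nat \<Rightarrow> real) \<Rightarrow> (nat \<Rightarrow> real)" and a :: "nat \<Rightarrow> nat \<Rightarrow> real"
    and m :: nat and \<sigma> :: real
  assumes volterra: "volterra_with a V"
    and block: "\<And>k i. k < m \<Longrightarrow> m \<le> i \<Longrightarrow> a k i = 0"
    and sgn_cases: "\<sigma> = 1 \<or> \<sigma> = - 1"
    and sign: "\<And>k i. m \<le> k \<Longrightarrow> k < i \<Longrightarrow> 0 \<le> \<sigma> * a k i"
begin

lemma skew: "a k i = - a i k"
  and bounded: "\<bar>a k i\<bar> \<le> 1"
  and V_in: "x \<in> l1_simplex 1 \<Longrightarrow> V x \<in> l1_simplex 1"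
  and V_apply: "x \<in> l1_simplex 1 \<Longrightarrow> V x k = x k * (1 + (\<Sum>i. a k i * x i))"
  using volterra unfolding volterra_with_def admissible_def by blast+

lemma block': "m \<le> k \<Longrightarrow> i < m \<Longrightarrow> a k i = 0"
  using block[of i k] skew[of k i] by simp

lemma series_summable:
  assumes "x \<in> l1_simplex 1"
  shows "summable (\<lambda>i. a k i * x i)"
proof (rule summable_comparison_test'[OF l1_simplexD(2)[OF assms]])
  fix i
  show "norm (a k i * x i) \<le> x i"
    using mult_right_mono[OF bounded l1_simplexD(1)[OF assms], of k i i] l1_simplexD(1)[OF assms, of i]
    by (simp add: abs_mult)
qed

text \<open>
  Exchanges of mass inside the interval cancel by skew-symmetry, and by assumption there are none with the
  coordinates below it, so only the exchange with the coordinates above remains.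
\<close>

lemma mass_flow:
  assumes x: "x \<in> l1_simplex 1" and "l \<le> n"
    and zero: "\<And>k i. l \<le> k \<Longrightarrow> k < n \<Longrightarrow> i < l \<Longrightarrow> a k i = 0"
  shows "(\<Sum>k\<in>{l..<n}. V x k) - (\<Sum>k\<in>{l..<n}. x k) =
         (\<Sum>k\<in>{l..<n}. x k * (\<Sum>i. a k (i + n) * x (i + n)))"
proof -
  have "V x k = x k + x k * (\<Sum>i\<in>{l..<n}. a k i * x i) + x k * (\<Sum>i. a k (i + n) * x (i + n))"
    if k: "k \<in> {l..<n}" for k
  proof -
    have "(\<Sum>i<n. a k i * x i) = (\<Sum>i\<in>{l..<n}. a k i * x i)"
      by (rule sum.mono_neutral_right) (use k zero[of k] in auto)
    then show ?thesis
      using V_apply[OF x, of k] suminf_split_initial_segment[OF series_summable[OF x, of k], of n]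
      by (simp add: algebra_simps)
  qed
  moreover have "(\<Sum>k\<in>{l..<n}. x k * (\<Sum>i\<in>{l..<n}. a k i * x i)) = 0"
    by (rule skew_form_zero) (rule skew)
  ultimately show ?thesis by (simp add: sum.distrib)
qed

lemma head_mass: "x \<in> l1_simplex 1 \<Longrightarrow> (\<Sum>k<m. V x k) = (\<Sum>k<m. x k)"
  using mass_flow[of x 0 m] by (simp add: lessThan_atLeast0 block)

lemma head_series:
  assumes "x \<in> l1_simplex 1" "k < m"
  shows "(\<Sum>i. a k i * x i) = (\<Sum>i<m. a k i * x i)"
  by (rule suminf_finite) (use block assms in auto)

text \<open>
  All contributions to the flow have the sign \<open>\<sigma>\<close>, so each single one is a lower bound.
  This yields both the monotonicity of the partial sums and, once the flow tends to 0, the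
  vanishing of every contribution.
\<close>

lemma tail_flow:
  assumes x: "x \<in> l1_simplex 1" and k: "m \<le> k" "k < n" and j: "n \<le> j"
  shows "\<sigma> * a k j * x k * x j \<le> \<sigma> * ((\<Sum>k\<in>{m..<n}. V x k) - (\<Sum>k\<in>{m..<n}. x k))"
proof -
  have nn: "0 \<le> \<sigma> * a l (i + n) * x (i + n)" if "m \<le> l" "l < n" for l i
    using sign[of l "i + n"] that l1_simplexD(1)[OF x] by simp
  have summ: "summable (\<lambda>i. \<sigma> * a l (i + n) * x (i + n))" for l
    using summable_mult[OF summable_ignore_initial_segment[OF series_summable[OF x, of l], of n], of \<sigma>]
    by (simp add: mult.assoc)
  have eq: "\<sigma> * ((\<Sum>k\<in>{m..<n}. V x k) - (\<Sum>k\<in>{m..<n}. x k)) =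
     (\<Sum>l\<in>{m..<n}. x l * (\<Sum>i. \<sigma> * a l (i + n) * x (i + n)))"
  proof -
    have "\<sigma> * (\<Sum>i. a l (i + n) * x (i + n)) = (\<Sum>i. \<sigma> * a l (i + n) * x (i + n))" for l
      using suminf_mult[OF summable_ignore_initial_segment[OF series_summable[OF x, of l], of n], of \<sigma>]
      by (simp add: mult.assoc)
    then show ?thesis
      using mass_flow[OF x, of m n] k block' by (simp add: sum_distrib_left mult.left_commute[of \<sigma>])
  qed
  have "\<sigma> * a k (j - n + n) * x (j - n + n) \<le> (\<Sum>i. \<sigma> * a k (i + n) * x (i + n))"
    using sum_le_suminf[OF summ[of k], of "{j - n}"] nn[OF k] by simp
  then have "x k * (\<sigma> * a k j * x j) \<le> x k * (\<Sum>i. \<sigma> * a k (i + n) * x (i + n))"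
    using j l1_simplexD(1)[OF x] by (simp add: mult_left_mono)
  also have "\<dots> \<le> (\<Sum>l\<in>{m..<n}. x l * (\<Sum>i. \<sigma> * a l (i + n) * x (i + n)))"
  proof (rule member_le_sum)
    show "0 \<le> x l * (\<Sum>i. \<sigma> * a l (i + n) * x (i + n))" if "l \<in> {m..<n} - {k}" for l
      by (rule mult_nonneg_nonneg[OF l1_simplexD(1)[OF x] suminf_nonneg[OF summ]])
         (use that nn in simp)
  qed (use k in simp_all)
  finally show ?thesis unfolding eq by (simp add: algebra_simps)
qed

lemma tail_flow_nonneg:
  assumes x: "x \<in> l1_simplex 1"
  shows "0 \<le> \<sigma> * ((\<Sum>k\<in>{m..<n}. V x k) - (\<Sum>k\<in>{m..<n}. x k))"
proof (cases "m < n")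
  case True
  have "0 \<le> \<sigma> * a m n * x m * x n"
    using sign[OF _ True] l1_simplexD(1)[OF x] by simp
  also have "\<dots> \<le> \<sigma> * ((\<Sum>k\<in>{m..<n}. V x k) - (\<Sum>k\<in>{m..<n}. x k))"
    by (rule tail_flow[OF x]) (use True in auto)
  finally show ?thesis .
qed simp

section \<open>Orbits and their weak limits\<close>

context
  fixes x0 :: "nat \<Rightarrow> real"
  assumes x0: "x0 \<in> l1_simplex 1"
begin

abbreviation orb :: "nat \<Rightarrow> nat \<Rightarrow> real" where "orb n \<equiv> (V ^^ n) x0"

lemma orb_in: "orb n \<in> l1_simplex 1"
  by (induction n) (use x0 V_in in auto)

lemma orb_head_mass: "(\<Sum>k<m. orb n k) = (\<Sum>k<m. x0 k)"
proof (induction n)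
  case (Suc n)
  then show ?case using head_mass[OF orb_in[of n]] by simp
qed simp

lemma orb_zero:
  assumes "orb n k = 0" "n \<le> n'"
  shows "orb n' k = 0"
  using assms(2)
proof (induction rule: dec_induct)
  case (step n')
  then show ?case using V_apply[OF orb_in[of n'], of k] by simp
qed (rule assms(1))

lemma tail_mass_signed_mono:
  assumes "t \<le> t'"
  shows "\<sigma> * (\<Sum>k\<in>{m..<n}. orb t k) \<le> \<sigma> * (\<Sum>k\<in>{m..<n}. orb t' k)"
  using assms
proof (induction rule: dec_induct)
  case (step t')
  then show ?case using tail_flow_nonneg[OF orb_in[of t'], of n] by (simp add: algebra_simps)
qed simp

lemma tail_mass_convergent: "convergent (\<lambda>t. \<Sum>k\<in>{m..<n}. orb t k)"
proof (rule Bseq_monoseq_convergent)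
  have "0 \<le> (\<Sum>k\<in>{m..<n}. orb t k)" "(\<Sum>k\<in>{m..<n}. orb t k) \<le> 1" for t
    using sum_le_l1_simplex[OF orb_in[of t]] l1_simplexD(1)[OF orb_in] by (auto intro: sum_nonneg)
  then show "Bseq (\<lambda>t. \<Sum>k\<in>{m..<n}. orb t k)" by (intro BseqI'[of _ 1]) simp
  show "monoseq (\<lambda>t. \<Sum>k\<in>{m..<n}. orb t k)"
    using tail_mass_signed_mono sgn_cases unfolding monoseq_def by fastforce
qed

lemma tail_coordinate_convergent:
  assumes "m \<le> k"
  shows "convergent (\<lambda>t. orb t k)"
  using convergent_diff[OF tail_mass_convergent[of "Suc k"] tail_mass_convergent[of k]] assms
  by simp

context
  fixes y :: "nat \<Rightarrow> real" and s :: "nat \<Rightarrow> nat"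
  assumes s: "strict_mono s" and lim: "\<And>k. (\<lambda>j. orb (s j) k) \<longlonglongrightarrow> y k"
begin

lemma limit_tail:
  assumes "m \<le> k"
  shows "(\<lambda>t. orb t k) \<longlonglongrightarrow> y k"
proof -
  obtain L where L: "(\<lambda>t. orb t k) \<longlonglongrightarrow> L"
    using tail_coordinate_convergent[OF assms] by (auto simp: convergent_def)
  then have "y k = L"
    using LIMSEQ_subseq_LIMSEQ[OF L s] LIMSEQ_unique[OF lim] by (simp add: comp_def)
  then show ?thesis using L by simp
qed

lemma limit_nonneg: "0 \<le> y k"
  by (rule LIMSEQ_le_const[OF lim]) (use l1_simplexD(1)[OF orb_in] in auto)

lemma limit_head_mass: "(\<Sum>k<m. y k) = (\<Sum>k<m. x0 k)"
proof -
  have "(\<lambda>j. \<Sum>k<m. orb (s j) k) \<longlonglongrightarrow> (\<Sum>k<m. y k)" by (intro tendsto_sum lim)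
  then show ?thesis unfolding orb_head_mass by (simp add: LIMSEQ_const_iff)
qed

lemma limit_summable: "summable y" and limit_mass_le: "suminf y \<le> 1"
proof -
  have le: "sum y I \<le> 1" if "finite I" for I
    by (rule LIMSEQ_le_const2[OF tendsto_sum[OF lim]]) (use sum_le_l1_simplex[OF orb_in that] in auto)
  show "summable y"
  proof (rule summableI_nonneg_bounded)
    show "0 \<le> y n" "sum y {..<n} \<le> 1" for n by (simp_all add: limit_nonneg le)
  qed
  then show "suminf y \<le> 1" by (rule suminf_le_const) (simp add: le)
qed

lemma limit_in_simplex: "y \<in> l1_simplex (suminf y)"
  using limit_nonneg limit_summable by (simp add: mem_l1_simplex_iff summable_sums)

lemma limit_norm:
  assumes "suminf y = 1"
  shows "(\<lambda>j. l1_norm (\<lambda>k. orb (s j) k - y k)) \<longlonglongrightarrow> 0"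
  by (rule pointwise_limit_equal_mass_imp_norm_limit[OF orb_in _ lim])
     (use limit_in_simplex assms in simp)

text \<open>
  For \<open>\<sigma> = 1\<close> the partial sums only grow, so each partial sum of \<open>y\<close> that includes the head is at
  least that of \<open>x0\<close>.
\<close>

lemma limit_mass_plus:
  assumes "\<sigma> = 1"
  shows "suminf y = 1"
proof (rule antisym[OF limit_mass_le])
  have "sum x0 {..<n} \<le> suminf y" for n
  proof -
    let ?N = "max m n"
    have split: "sum z {..<?N} = sum z {..<m} + sum z {m..<?N}" for z :: "nat \<Rightarrow> real"
      unfolding lessThan_atLeast0 by (rule sum.atLeastLessThan_concat[symmetric]) auto
    have "sum x0 {m..<?N} \<le> sum y {m..<?N}"
    proof (rule LIMSEQ_le_const[OF tendsto_sum[OF lim]])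
      show "\<exists>N. \<forall>j\<ge>N. sum x0 {m..<?N} \<le> (\<Sum>k\<in>{m..<?N}. orb (s j) k)"
        using tail_mass_signed_mono[of 0 "s _" ?N] assms by simp
    qed
    then have "sum x0 {..<?N} \<le> sum y {..<?N}"
      unfolding split limit_head_mass by simp
    moreover have "sum x0 {..<n} \<le> sum x0 {..<?N}"
      by (rule sum_mono2) (use l1_simplexD(1)[OF x0] in auto)
    moreover have "sum y {..<?N} \<le> suminf y"
      by (rule sum_le_suminf) (use limit_summable limit_nonneg in auto)
    ultimately show ?thesis by linarith
  qed
  then show "1 \<le> suminf y"
    using suminf_le_const[OF l1_simplexD(2)[OF x0]] l1_simplexD(3)[OF x0] by auto
qed

lemma limit_tail_interactions_vanish:
  assumes k: "m \<le> k" "k < i"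
  shows "a k i * y k * y i = 0"
proof -
  obtain L where L: "(\<lambda>t. \<Sum>k\<in>{m..<i}. orb t k) \<longlonglongrightarrow> L"
    using tail_mass_convergent by (auto simp: convergent_def)
  have flow: "(\<lambda>t. \<sigma> * ((\<Sum>k\<in>{m..<i}. orb (Suc t) k) - (\<Sum>k\<in>{m..<i}. orb t k))) \<longlonglongrightarrow> 0"
    using tendsto_mult_right_zero[OF LIM_zero[OF tendsto_diff[OF LIMSEQ_Suc[OF L] L]], of \<sigma>] by simp
  have term_lim: "(\<lambda>t. \<sigma> * a k i * orb t k * orb t i) \<longlonglongrightarrow> \<sigma> * a k i * y k * y i"
    by (intro tendsto_mult tendsto_const limit_tail) (use k in auto)
  have "\<sigma> * a k i * y k * y i \<le> 0"
    by (rule LIMSEQ_le[OF term_lim flow]) (use tail_flow[OF orb_in k] in auto)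
  moreover have "0 \<le> \<sigma> * a k i * y k * y i"
    using sign[OF k] limit_nonneg by simp
  ultimately show ?thesis using sgn_cases by auto
qed

text \<open>
  A positive weak limit forces the tail block of the matrix to be 0, so the tail does not move; the
  head is a finite Volterra orbit with an interior limit point.
\<close>

lemma interior_limit_imp_fixed:
  assumes y: "\<And>k. 0 < y k"
  shows "V x0 = x0"
proof
  fix k
  have a0: "a k i = 0" if k: "m \<le> k" for k i
  proof -
    have up: "a k i = 0" if "m \<le> k" "k < i" for k i
      using limit_tail_interactions_vanish[OF that] y[of k] y[of i] by simp
    consider "i < m" | "m \<le> i" "i < k" | "i = k" | "k < i" by linarith
    then show ?thesis
    proof cases
      case 1
      then show ?thesis by (rule block'[OF k])
    next
      case 2
      then show ?thesis using up[of i k] skew[of k i] by linarith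
    next
      case 3
      then show ?thesis using skew[of k k] by simp
    next
      case 4
      then show ?thesis by (rule up[OF k])
    qed
  qed
  \<comment> \<open>A coordinate that vanishes once stays 0 and would vanish in the limit.\<close>
  have pos: "0 < orb n k" for n k
  proof (rule ccontr)
    assume "\<not> 0 < orb n k"
    then have 0: "orb n k = 0" using l1_simplexD(1)[OF orb_in, of n k] by linarith
    have "\<forall>j\<ge>n. orb (s j) k = 0"
      using orb_zero[OF 0] seq_suble[OF s] order_trans by blast
    then have "(\<lambda>j. orb (s j) k) \<longlonglongrightarrow> 0"
      by (intro tendsto_eventually) (auto simp: eventually_sequentially)
    then show False using LIMSEQ_unique[OF lim] y[of k] by force
  qed
  interpret finite_volterra_orbit a m orb
  proof
    show "(\<Sum>k<m. orb n k) \<le> 1" for n by (rule sum_le_l1_simplex[OF orb_in]) simp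
    show "orb (Suc n) k = orb n k * (1 + (\<Sum>i<m. a k i * orb n i))" if "k < m" for k n
      using V_apply[OF orb_in, of n k] head_series[OF orb_in that] by simp
  qed (rule skew bounded pos)+
  show "V x0 k = x0 k"
  proof (cases "k < m")
    case True
    have "(\<Sum>i<m. a k i * orb 0 i) = 0"
      by (rule interior_limit_imp_start_fixed[OF s _ _ True]) (use lim y in auto)
    then show ?thesis using V_apply[OF x0, of k] head_series[OF x0 True] by simp
  next
    case False
    then show ?thesis using V_apply[OF x0, of k] a0 by simp
  qed
qed

end

lemma omega_weak_mass_le:
  assumes "y \<in> omega_weak V x0"
  shows "y \<in> l1_simplex (suminf y)" "0 \<le> suminf y" "suminf y \<le> 1"
proof -
  obtain s where s: "strict_mono s" "\<And>k. (\<lambda>j. orb (s j) k) \<longlonglongrightarrow> y k"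
    using assms unfolding omega_weak_def by blast
  show "y \<in> l1_simplex (suminf y)" by (rule limit_in_simplex[OF s])
  show "0 \<le> suminf y" by (rule suminf_nonneg[OF limit_summable[OF s] limit_nonneg[OF s]])
  show "suminf y \<le> 1" by (rule limit_mass_le[OF s])
qed

lemma omega_weak_equal_mass:
  assumes "y \<in> omega_weak V x0" "y' \<in> omega_weak V x0"
  shows "suminf y = suminf y'"
proof -
  obtain s s' where s: "strict_mono s" "\<And>k. (\<lambda>j. orb (s j) k) \<longlonglongrightarrow> y k"
    and s': "strict_mono s'" "\<And>k. (\<lambda>j. orb (s' j) k) \<longlonglongrightarrow> y' k"
    using assms unfolding omega_weak_def by blast
  have "y (k + m) = y' (k + m)" for k
    using limit_tail[OF s, of "k + m"] limit_tail[OF s', of "k + m"] LIMSEQ_unique by force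
  then show ?thesis
    using suminf_split_initial_segment[OF limit_summable[OF s], of m]
      suminf_split_initial_segment[OF limit_summable[OF s'], of m]
      limit_head_mass[OF s] limit_head_mass[OF s'] by simp
qed

lemma omega_weak_subset_bd:
  assumes "x0 \<notin> Fix V" "y \<in> omega_weak V x0"
  shows "y \<in> bd_simplex (suminf y)"
proof -
  have "\<not> (\<forall>k. 0 < y k)"
    using assms interior_limit_imp_fixed x0 unfolding omega_weak_def Fix_def by blast
  then show ?thesis
    using omega_weak_mass_le(1)[OF assms(2)] by (auto simp: bd_simplex_def ri_simplex_def)
qed

text \<open>
  Norm limits have mass 1 since the norm controls both the coordinates and the mass; the converse
  is Scheffe's argument.
\<close>

lemma omega_norm_eq: "omega_norm V x0 = {y \<in> omega_weak V x0. suminf y = 1}"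
proof (intro equalityI subsetI)
  fix y assume "y \<in> omega_norm V x0"
  then obtain s where y: "y \<in> l1" and s: "strict_mono s"
    and lim: "(\<lambda>j. l1_norm (\<lambda>k. orb (s j) k - y k)) \<longlonglongrightarrow> 0"
    unfolding omega_norm_def by blast
  have sum_y: "summable y" using y by (auto simp: l1_def intro: summable_rabs_cancel)
  have summ: "summable (\<lambda>k. \<bar>orb n k - y k\<bar>)" for n
  proof (rule summable_comparison_test')
    show "summable (\<lambda>k. orb n k + \<bar>y k\<bar>)"
      using y l1_simplexD(2)[OF orb_in] by (auto simp: l1_def intro: summable_add)
    show "norm \<bar>orb n k - y k\<bar> \<le> orb n k + \<bar>y k\<bar>" for k
      using l1_simplexD(1)[OF orb_in, of n k] by simp
  qed
  have "(\<lambda>j. orb (s j) k) \<longlonglongrightarrow> y k" for k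
  proof (rule LIM_zero_cancel, rule Lim_null_comparison[OF _ lim])
    show "\<forall>\<^sub>F j in sequentially. norm (orb (s j) k - y k) \<le> l1_norm (\<lambda>k. orb (s j) k - y k)"
      using sum_le_suminf[OF summ, of "{k}"] by (simp add: l1_norm_def)
  qed
  then have "y \<in> omega_weak V x0" using s unfolding omega_weak_def by blast
  moreover have "(\<lambda>j. 1 - suminf y) \<longlonglongrightarrow> 0"
  proof (rule Lim_null_comparison[OF _ lim])
    have "norm (1 - suminf y) \<le> l1_norm (\<lambda>k. orb n k - y k)" for n
      using summable_rabs[OF summ] suminf_diff[OF l1_simplexD(2)[OF orb_in] sum_y, of n]
        l1_simplexD(3)[OF orb_in, of n] by (simp add: l1_norm_def)
    then show "\<forall>\<^sub>F j in sequentially. norm (1 - suminf y) \<le> l1_norm (\<lambda>k. orb (s j) k - y k)"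
      by simp
  qed
  then have "suminf y = 1" by (simp add: LIMSEQ_const_iff)
  ultimately show "y \<in> {y \<in> omega_weak V x0. suminf y = 1}" by simp
next
  fix y assume "y \<in> {y \<in> omega_weak V x0. suminf y = 1}"
  then obtain s where s: "strict_mono s" "\<And>k. (\<lambda>j. orb (s j) k) \<longlonglongrightarrow> y k" and 1: "suminf y = 1"
    unfolding omega_weak_def by blast
  have "y \<in> l1" using limit_in_simplex[OF s] by (simp add: l1_simplex_def)
  then show "y \<in> omega_norm V x0"
    using s(1) limit_norm[OF s 1] unfolding omega_norm_def by blast
qed

end

end

section \<open>Limit sets of the operators of both classes\<close>

theorem theorem1p1:
  fixes V :: "(nat \<Rightarrow> real) \<Rightarrow> (nat \<Rightarrow> real)"
  assumes "V \<in> volterra_plus \<union> volterra_minus"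
    and "V \<noteq> Id_op"
  shows "(V \<in> volterra_plus \<longrightarrow>
            (\<forall>x0\<in>l1_simplex 1. omega_norm V x0 = omega_weak V x0) \<and>
            (\<forall>x0\<in>l1_simplex 1 - Fix V. omega_weak V x0 \<subseteq> bd_simplex 1)) \<and>
         (V \<in> volterra_minus \<longrightarrow>
            (\<forall>x0\<in>l1_simplex 1 - Fix V.
               (omega_norm V x0 \<noteq> {} \<longrightarrow>
                  omega_norm V x0 = omega_weak V x0 \<and> omega_weak V x0 \<subseteq> bd_simplex 1) \<and>
               (omega_norm V x0 = {} \<longrightarrow>
                  (\<exists>r. 0 \<le> r \<and> r < 1 \<and> omega_weak V x0 \<subseteq> bd_simplex r))))"
proof (intro conjI impI)
  assume "V \<in> volterra_plus"
  then obtain a m where "volterra_with a V" "\<forall>k i. k < m \<and> m \<le> i \<longrightarrow> a k i = 0"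
    and "\<forall>k i. m \<le> k \<and> k < i \<longrightarrow> 0 \<le> a k i"
    unfolding volterra_plus_def by blast
  then interpret block_signed_volterra V a m 1 by unfold_locales auto
  have mass: "suminf y = 1" if "x0 \<in> l1_simplex 1" "y \<in> omega_weak V x0" for x0 y
    using that limit_mass_plus unfolding omega_weak_def by blast
  show "\<forall>x0\<in>l1_simplex 1. omega_norm V x0 = omega_weak V x0"
    using omega_norm_eq mass by blast
  show "\<forall>x0\<in>l1_simplex 1 - Fix V. omega_weak V x0 \<subseteq> bd_simplex 1"
    using omega_weak_subset_bd mass by fastforce
next
  assume "V \<in> volterra_minus"
  then obtain a m where "volterra_with a V" "\<forall>k i. k < m \<and> m \<le> i \<longrightarrow> a k i = 0"
    and "\<forall>k i. m \<le> k \<and> k < i \<longrightarrow> a k i \<le> 0"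
    unfolding volterra_minus_def by blast
  then interpret block_signed_volterra V a m "- 1" by unfold_locales auto
  show "\<forall>x0\<in>l1_simplex 1 - Fix V.
          (omega_norm V x0 \<noteq> {} \<longrightarrow>
             omega_norm V x0 = omega_weak V x0 \<and> omega_weak V x0 \<subseteq> bd_simplex 1) \<and>
          (omega_norm V x0 = {} \<longrightarrow>
             (\<exists>r. 0 \<le> r \<and> r < 1 \<and> omega_weak V x0 \<subseteq> bd_simplex r))"
  proof (intro ballI conjI impI)
    fix x0 assume "x0 \<in> l1_simplex 1 - Fix V"
    then have x0: "x0 \<in> l1_simplex 1" "x0 \<notin> Fix V" by auto
    note bd = omega_weak_subset_bd[OF x0] and eq = omega_weak_equal_mass[OF x0(1)]
    {
      assume "omega_norm V x0 \<noteq> {}"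
      then obtain z where z: "z \<in> omega_weak V x0" "suminf z = 1"
        unfolding omega_norm_eq[OF x0(1)] by blast
      have mass: "suminf y = 1" if "y \<in> omega_weak V x0" for y using eq[OF that z(1)] z(2) by simp
      then show "omega_norm V x0 = omega_weak V x0" unfolding omega_norm_eq[OF x0(1)] by blast
      show "omega_weak V x0 \<subseteq> bd_simplex 1" using bd mass by fastforce
    }
    assume none: "omega_norm V x0 = {}"
    show "\<exists>r. 0 \<le> r \<and> r < 1 \<and> omega_weak V x0 \<subseteq> bd_simplex r"
    proof (cases "omega_weak V x0 = {}")
      case True
      then show ?thesis by (intro exI[of _ 0]) simp
    next
      case False
      then obtain z where z: "z \<in> omega_weak V x0" by blast
      have "suminf z \<noteq> 1" using none z unfolding omega_norm_eq[OF x0(1)] by blast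
      moreover have "omega_weak V x0 \<subseteq> bd_simplex (suminf z)"
        using bd eq[OF _ z] by fastforce
      ultimately show ?thesis
        using omega_weak_mass_le[OF x0(1) z] by (intro exI[of _ "suminf z"]) auto
    qed
  qed
qed

end
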